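(* Let $G$ be a graph that contains an induced $(n,m)$-necklace with $n\ge 5$ and $m\ge 1$ whose cycle has good neighbours in $G$. Then either $KB_e^2(G)$ or $KB_e^3(G)$ contains an induced $(n,m')$-necklace with $m'>m$ whose cycle has good neighbours (in $KB_e^2(G)$, resp. $KB_e^3(G)$).
   Context: All graphs are finite, simple and undirected. A biclique of a graph $G$ is a maximal (with respect to inclusion) induced subgraph of $G$ that is a complete bipartite graph $K_{p,q}$ with $p,q\ge 1$. The edge-biclique graph $KB_e(G)$ has one vertex for each biclique of $G$, two distinct vertices being adjacent iff the corresponding bicliques share at least one edge; $KB_e^0(G)=G$, $KB_e^k(G)=KB_e(KB_e^{k-1}(G))$. For $n\ge3$, $m\ge1$, the $(n,m)$-necklace is the graph on $n+m$ vertices consisting of an induced cycle $C_n$ and a complete graph $K_m$ such that, for one fixed edge $xy$ of the cycle, every vertex of the $K_m$ is adjacent to $x$ and $y$ and to no other vertex of the cycle. An induced cycle $C=v_0\ldots v_{n-1}$ ($n\ge5$) of a graph $H$ has good neighbours in $H$ if for every vertex $v\in V(H)\setminus V(C)$ and every $i$ (indices mod $n$), $\{v_{i-1},v_{i+1}\}\subseteq N(v)$ implies $v_i\in N(v)$. *)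

theory Defs
  imports Main
begin

type_synonym 'a graph = "'a set \<times> 'a set set"

definition verts :: "'a graph \<Rightarrow> 'a set" where "verts G = fst G"
definition edges :: "'a graph \<Rightarrow> 'a set set" where "edges G = snd G"

definition finite_simple_graph :: "'a graph \<Rightarrow> bool" where
  "finite_simple_graph G \<longleftrightarrow> finite (verts G) \<and>
     (\<forall>e\<in>edges G. \<exists>u v. u \<noteq> v \<and> e = {u, v} \<and> u \<in> verts G \<and> v \<in> verts G)"

definition adj :: "'a graph \<Rightarrow> 'a \<Rightarrow> 'a \<Rightarrow> bool" where
  "adj G u v \<longleftrightarrow> {u, v} \<in> edges G"

definition induces_complete_bipartite :: "'a graph \<Rightarrow> 'a set \<Rightarrow> bool" where
  "induces_complete_bipartite G S \<longleftrightarrow> S \<subseteq> verts G \<and>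
     (\<exists>A B. A \<noteq> {} \<and> B \<noteq> {} \<and> A \<inter> B = {} \<and> A \<union> B = S \<and>
        (\<forall>x\<in>S. \<forall>y\<in>S. adj G x y \<longleftrightarrow> (x \<in> A \<and> y \<in> B \<or> x \<in> B \<and> y \<in> A)))"

definition biclique :: "'a graph \<Rightarrow> 'a set \<Rightarrow> bool" where
  "biclique G S \<longleftrightarrow> induces_complete_bipartite G S \<and>
     (\<forall>T. induces_complete_bipartite G T \<and> S \<subseteq> T \<longrightarrow> T = S)"

definition KBe :: "'a graph \<Rightarrow> 'a set graph" where
  "KBe G = ({S. biclique G S},
            {{S, T} | S T. S \<noteq> T \<and> biclique G S \<and> biclique G T \<and>
                           (\<exists>e\<in>edges G. e \<subseteq> S \<inter> T)})"

definition induced_necklace :: "'a graph \<Rightarrow> nat \<Rightarrow> nat \<Rightarrow> 'a list \<Rightarrow> 'a set \<Rightarrow> bool" where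
  "induced_necklace H n m cyc K \<longleftrightarrow> 3 \<le> n \<and> 1 \<le> m \<and>
     length cyc = n \<and> distinct cyc \<and> set cyc \<subseteq> verts H \<and>
     K \<subseteq> verts H \<and> finite K \<and> card K = m \<and> K \<inter> set cyc = {} \<and>
     (\<forall>i<n. \<forall>j<n. adj H (cyc ! i) (cyc ! j) \<longleftrightarrow> (j = (i + 1) mod n \<or> i = (j + 1) mod n)) \<and>
     (\<forall>u\<in>K. \<forall>w\<in>K. u \<noteq> w \<longrightarrow> adj H u w) \<and>
     (\<exists>j<n. \<forall>u\<in>K. \<forall>i<n. adj H u (cyc ! i) \<longleftrightarrow> (i = j \<or> i = (j + 1) mod n))"

definition good_neighbours :: "'a graph \<Rightarrow> 'a list \<Rightarrow> bool" where
  "good_neighbours H cyc \<longleftrightarrow>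
     (\<forall>v \<in> verts H - set cyc. \<forall>i < length cyc.
        adj H v (cyc ! ((i + length cyc - 1) mod length cyc)) \<and>
        adj H v (cyc ! ((i + 1) mod length cyc)) \<longrightarrow> adj H v (cyc ! i))"

definition has_good_necklace :: "'a graph \<Rightarrow> nat \<Rightarrow> nat \<Rightarrow> bool" where
  "has_good_necklace H n m \<longleftrightarrow>
     (\<exists>cyc K. induced_necklace H n m cyc K \<and> good_neighbours H cyc)"

end

(* If a good cycle v_0 ... v_{n-1} is given, every biclique containing v_{i-1} v_i v_{i+1} is a star
   centred at v_i, and choosing one for each i gives a good cycle B_0 ... B_{n-1} of the edge-biclique
   graph.  A vertex u attached to v_i v_{i+1} yields one biclique attached to B_{i-1} B_i (extending
   v_{i-1} v_i u) and one attached to B_{i+1} B_{i+2} (extending u v_{i+1} v_{i+2}), and distinct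
   adjacent u yield distinct adjacent bicliques.  Start with the m-clique attached to v_0 v_1.  The
   moves left, right, right carry all of it to position 1 of the third graph; the moves right, right,
   left carry one of its vertices there as well.  After two moves the images of the first kind share
   no edge with the image of the second kind (no_shared_edge), so the third move cannot identify
   them, and m + 1 vertices are attached to one edge.  Hence the third graph always works. *)

theory Submission
  imports Defs
begin

section \<open>Bicliques of finite simple graphs\<close>

lemma adj_commute: "adj H x y \<longleftrightarrow> adj H y x"
  by (simp add: adj_def insert_commute)

lemma adj_verts:
  assumes "finite_simple_graph H" "adj H x y"
  shows "x \<in> verts H" "y \<in> verts H" "x \<noteq> y"
proof -
  from assms obtain u v where "u \<noteq> v" "{x, y} = {u, v}" "u \<in> verts H" "v \<in> verts H"
    unfolding finite_simple_graph_def adj_def by metis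
  then show "x \<in> verts H" "y \<in> verts H" "x \<noteq> y"
    by (auto simp: doubleton_eq_iff)
qed

text \<open>Adjacency inside a complete bipartite graph means lying on different sides, and
  differing is additive modulo 2. This exclusive-or rule replaces the bipartition in every later
  argument.\<close>

lemma complete_bipartite_adj_iff:
  assumes "induces_complete_bipartite H S" "x \<in> S" "y \<in> S" "z \<in> S"
  shows "adj H x z \<longleftrightarrow> (adj H x y \<noteq> adj H y z)"
proof -
  from assms(1) obtain A B where "A \<inter> B = {}" "A \<union> B = S"
    "\<forall>x\<in>S. \<forall>y\<in>S. adj H x y \<longleftrightarrow> (x \<in> A \<and> y \<in> B \<or> x \<in> B \<and> y \<in> A)"
    unfolding induces_complete_bipartite_def by blast
  then show ?thesis
    using assms(2-) by blast
qed

lemma biclique_adj_iff: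
  "biclique H S \<Longrightarrow> x \<in> S \<Longrightarrow> y \<in> S \<Longrightarrow> z \<in> S \<Longrightarrow> adj H x z \<longleftrightarrow> (adj H x y \<noteq> adj H y z)"
  unfolding biclique_def using complete_bipartite_adj_iff by metis

lemma biclique_subset: "biclique H S \<Longrightarrow> S \<subseteq> verts H"
  by (simp add: biclique_def induces_complete_bipartite_def)

text \<open>A choice depending only on \<open>X\<close>, so that equal paths get equal bicliques;
  \<open>star_eq\<close> relies on this.\<close>

definition biclique_ext :: "'a graph \<Rightarrow> 'a set \<Rightarrow> 'a set" where
  "biclique_ext H X = (SOME S. biclique H S \<and> X \<subseteq> S)"

text \<open>A finite graph has finitely many complete bipartite vertex sets, so \<open>X\<close>
  lies in a maximal one, which is a biclique.\<close>

lemma biclique_ext: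
  assumes "finite_simple_graph H" "induces_complete_bipartite H X"
  shows "biclique H (biclique_ext H X)" "X \<subseteq> biclique_ext H X"
proof -
  have "finite {S. induces_complete_bipartite H S}"
    using assms(1) unfolding finite_simple_graph_def
    by (auto intro: finite_subset[of _ "Pow (verts H)"] simp: induces_complete_bipartite_def)
  from finite_has_maximal2[OF this, of X] assms(2)
  obtain S where "induces_complete_bipartite H S" "X \<subseteq> S"
    "\<forall>T\<in>{S. induces_complete_bipartite H S}. S \<subseteq> T \<longrightarrow> S = T"
    by auto
  then have "\<exists>S. biclique H S \<and> X \<subseteq> S"
    unfolding biclique_def by blast
  then show "biclique H (biclique_ext H X)" "X \<subseteq> biclique_ext H X"
    unfolding biclique_ext_def by (metis (mono_tags, lifting) someI_ex)+
qed

lemma induced_path_complete_bipartite: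
  assumes "finite_simple_graph H" "adj H x y" "adj H y z" "\<not> adj H x z"
  shows "induces_complete_bipartite H {x, y, z}"
proof -
  have "\<not> adj H w w" for w
    using adj_verts[OF assms(1)] by blast
  then show ?thesis
    unfolding induces_complete_bipartite_def
    using assms adj_verts[OF assms(1,2)] adj_verts[OF assms(1,3)]
    by (intro conjI exI[of _ "{y}"] exI[of _ "{x, z}"]) (auto simp: adj_commute)
qed

lemma biclique_ext_path:
  assumes "finite_simple_graph H" "adj H x y" "adj H y z" "\<not> adj H x z"
  shows "biclique H (biclique_ext H {x, y, z})"
    "x \<in> biclique_ext H {x, y, z}" "y \<in> biclique_ext H {x, y, z}" "z \<in> biclique_ext H {x, y, z}"
  using biclique_ext[OF assms(1) induced_path_complete_bipartite[OF assms]] by auto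

section \<open>Adjacency in the edge-biclique graph\<close>

definition share_edge :: "'a graph \<Rightarrow> 'a set \<Rightarrow> 'a set \<Rightarrow> bool" where
  "share_edge H S T \<longleftrightarrow> (\<exists>x\<in>S \<inter> T. \<exists>y\<in>S \<inter> T. adj H x y)"

lemma share_edgeI: "adj H x y \<Longrightarrow> {x, y} \<subseteq> S \<Longrightarrow> {x, y} \<subseteq> T \<Longrightarrow> share_edge H S T"
  unfolding share_edge_def by blast

lemma verts_KBe: "verts (KBe H) = {S. biclique H S}"
  by (simp add: verts_def KBe_def)

lemma adj_KBe:
  assumes "finite_simple_graph H"
  shows "adj (KBe H) S T \<longleftrightarrow> S \<noteq> T \<and> biclique H S \<and> biclique H T \<and> share_edge H S T"
proof -
  have share: "(\<exists>e\<in>edges H. e \<subseteq> S \<inter> T) \<longleftrightarrow> share_edge H S T" for S T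
  proof
    assume "\<exists>e\<in>edges H. e \<subseteq> S \<inter> T"
    then obtain e where e: "e \<in> edges H" "e \<subseteq> S \<inter> T" ..
    moreover from e(1) obtain x y where "e = {x, y}"
      using assms unfolding finite_simple_graph_def by metis
    ultimately show "share_edge H S T"
      unfolding share_edge_def adj_def by blast
  next
    assume "share_edge H S T"
    then obtain x y where "{x, y} \<in> edges H" "{x, y} \<subseteq> S \<inter> T"
      by (auto simp: share_edge_def adj_def)
    then show "\<exists>e\<in>edges H. e \<subseteq> S \<inter> T" ..
  qed
  have "edges (KBe H) = {{S, T} | S T. S \<noteq> T \<and> biclique H S \<and> biclique H T \<and> share_edge H S T}"
    unfolding share[symmetric] by (simp add: edges_def KBe_def)
  then have "adj (KBe H) S T \<longleftrightarrow> (\<exists>S' T'. {S, T} = {S', T'} \<and> S' \<noteq> T' \<and> biclique H S' \<and> biclique H T'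
      \<and> share_edge H S' T')"
    by (simp add: adj_def)
  moreover have "share_edge H T S \<longleftrightarrow> share_edge H S T"
    by (simp add: share_edge_def Int_commute)
  ultimately show ?thesis
    unfolding doubleton_eq_iff by metis
qed

lemma finite_simple_graph_KBe:
  assumes "finite_simple_graph H"
  shows "finite_simple_graph (KBe H)"
  unfolding finite_simple_graph_def
proof
  show "finite (verts (KBe H))"
    using assms biclique_subset[of H] unfolding finite_simple_graph_def
    by (auto intro!: finite_subset[of _ "Pow (verts H)"] simp: verts_KBe)
next
  show "\<forall>e\<in>edges (KBe H). \<exists>S T. S \<noteq> T \<and> e = {S, T} \<and> S \<in> verts (KBe H) \<and> T \<in> verts (KBe H)"
    unfolding verts_KBe unfolding edges_def KBe_def by (simp, blast)
qed

section \<open>Good cycles and the cycle formed by their stars\<close>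

text \<open>Cycles are indexed by all integers, periodically, so that rotations become shifts of the
  index and no reduction modulo the length is needed.\<close>

locale good_cycle =
  fixes H :: "'a graph" and n :: int and c :: "int \<Rightarrow> 'a"
  assumes fsg: "finite_simple_graph H"
    and n_ge: "5 \<le> n"
    and c_verts: "c i \<in> verts H"
    and c_eq: "c i = c j \<longleftrightarrow> n dvd i - j"
    and c_adj: "adj H (c i) (c j) \<longleftrightarrow> n dvd i - j - 1 \<or> n dvd i - j + 1"
    and good: "v \<in> verts H \<Longrightarrow> v \<notin> range c \<Longrightarrow> adj H v (c (i - 1)) \<Longrightarrow> adj H v (c (i + 1)) \<Longrightarrow> adj H v (c i)"
begin

lemma n_dvd_small: "\<bar>k\<bar> < 5 \<Longrightarrow> n dvd k \<longleftrightarrow> k = 0"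
  using n_ge dvd_imp_le_int[of k n] by auto

text \<open>The simplifier turns divisibility of 1 by \<open>n\<close> into this equation, which has
  to be refuted.\<close>

lemma abs_n_neq_one [simp]: "\<bar>n\<bar> \<noteq> 1"
  using n_ge by linarith

lemma c_near:
  "adj H (c i) (c (i + 1))" "adj H (c (i - 1)) (c i)"
  "\<not> adj H (c (i - 1)) (c (i + 1))" "\<not> adj H (c i) (c (i + 2))" "\<not> adj H (c i) (c (i + 3))"
  by (simp_all add: c_adj n_dvd_small)

text \<open>Extends \<open>good\<close> to vertices on the cycle: a cycle vertex other than
  \<open>c i\<close> with both neighbours would make \<open>n\<close> divide 4, against
  \<open>5 \<le> n\<close>.\<close>

lemma common_neighbour:
  assumes "adj H v (c (i - 1))" "adj H v (c (i + 1))"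
  shows "v = c i \<or> adj H v (c i)"
proof (cases "v \<in> range c")
  case True
  then obtain k where v: "v = c k" by blast
  have "n dvd k - i"
  proof (rule ccontr)
    assume "\<not> n dvd k - i"
    with assms have "n dvd k - i + 2" "n dvd k - i - 2"
      by (auto simp: v c_adj algebra_simps)
    then have "n dvd (k - i + 2) - (k - i - 2)" by (rule dvd_diff)
    then show False by (simp add: n_dvd_small)
  qed
  then show ?thesis by (simp add: v c_eq)
next
  case False
  then show ?thesis
    using good assms adj_verts(1)[OF fsg assms(1)] by blast
qed

definition star :: "int \<Rightarrow> 'a set" where
  "star i = biclique_ext H {c (i - 1), c i, c (i + 1)}"

lemma star_biclique: "biclique H (star i)"
  and star_mem: "c (i - 1) \<in> star i" "c i \<in> star i" "c (i + 1) \<in> star i"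
  unfolding star_def using biclique_ext_path[OF fsg c_near(2,1,3)] by blast+

text \<open>A vertex of \<open>S\<close> on the side of \<open>c i\<close> is adjacent to
  \<open>c (i - 1)\<close> and \<open>c (i + 1)\<close>, hence equals \<open>c i\<close> by
  \<open>common_neighbour\<close>. So that side is a single vertex, and every edge of
  \<open>S\<close> meets it.\<close>

lemma star_edge:
  assumes "biclique H S" "c (i - 1) \<in> S" "c i \<in> S" "c (i + 1) \<in> S"
    and "x \<in> S" "y \<in> S" "adj H x y"
  shows "x = c i \<or> y = c i"
proof -
  have *: "z = c i" if z: "z \<in> S" "\<not> adj H z (c i)" for z
  proof -
    have "adj H z (c (i - 1))" "adj H z (c (i + 1))"
      using biclique_adj_iff[OF assms(1) z(1) assms(3) assms(2)]
        biclique_adj_iff[OF assms(1) z(1) assms(3) assms(4)] z(2) c_near[of i]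
      by (auto simp: adj_commute)
    then show ?thesis using common_neighbour z(2) by blast
  qed
  have "\<not> adj H x (c i) \<or> \<not> adj H y (c i)"
    using biclique_adj_iff[OF assms(1,5,3,6)] assms(7) by (auto simp: adj_commute)
  then show ?thesis using * assms(5,6) by blast
qed

lemma share_star:
  assumes "share_edge H S (star i)"
  obtains a where "c i \<in> S" "a \<in> S" "a \<in> star i" "adj H (c i) a"
proof -
  from assms obtain x y where xy: "x \<in> S" "y \<in> S" "x \<in> star i" "y \<in> star i" "adj H x y"
    unfolding share_edge_def by blast
  then have "x = c i \<or> y = c i"
    using star_edge[OF star_biclique star_mem] by blast
  then show thesis
    using xy that adj_commute[of H x y] by blast
qed

text \<open>This carries goodness over to the next graph. The shared edge at
  \<open>c (i - 1)\<close> has a second end \<open>a\<close>. In \<open>S\<close> the vertices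
  \<open>c (i - 1)\<close> and \<open>c (i + 1)\<close> are on one side, so \<open>a\<close> is a
  common neighbour of both; \<open>a\<close> and \<open>c i\<close> are leaves of the same star and
  thus nonadjacent, which leaves only \<open>a = c i\<close>.\<close>

lemma share_star_both:
  assumes S: "biclique H S" and "share_edge H S (star (i - 1))" "share_edge H S (star (i + 1))"
  shows "c (i - 1) \<in> S" "c i \<in> S" "c (i + 1) \<in> S"
proof -
  from assms(2) obtain a where a: "c (i - 1) \<in> S" "a \<in> S" "a \<in> star (i - 1)" "adj H (c (i - 1)) a"
    by (rule share_star)
  from assms(3) show ci: "c (i + 1) \<in> S"
    by (rule share_star)
  show "c (i - 1) \<in> S" by (fact a)
  have "adj H a (c (i + 1))"
    using biclique_adj_iff[OF S a(2,1) ci] a(4) c_near(3) by (auto simp: adj_commute)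
  then have "a = c i \<or> adj H a (c i)"
    using a(4) by (intro common_neighbour) (auto simp: adj_commute)
  moreover have "\<not> adj H a (c i)"
    using biclique_adj_iff[OF star_biclique a(3) star_mem(2), of "c i"] star_mem(3)[of "i - 1"]
      a(4) c_near(2)[of i] by (auto simp: adj_commute)
  ultimately show "c i \<in> S" using a by blast
qed

text \<open>The centre is determined by the star: it is the only common end of the edges from
  \<open>c i\<close> to \<open>c (i - 1)\<close> and to \<open>c (i + 1)\<close>.\<close>

lemma star_eq: "star i = star j \<longleftrightarrow> n dvd i - j"
proof
  assume eq: "star i = star j"
  have "c j = c i \<or> c j = c (i - 1)" "c j = c i \<or> c j = c (i + 1)"
    using star_edge[OF star_biclique star_mem, of "c (i - 1)" j "c i"]
      star_edge[OF star_biclique star_mem, of "c i" j "c (i + 1)"]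
      star_mem[of i] c_near[of i] unfolding eq by metis+
  moreover have "c (i - 1) \<noteq> c (i + 1)"
    by (simp add: c_eq n_dvd_small)
  ultimately have "c i = c j" by metis
  then show "n dvd i - j" by (simp add: c_eq)
next
  assume "n dvd i - j"
  then have "c (i + k) = c (j + k)" for k
    by (simp add: c_eq)
  from this[of "-1"] this[of 0] this[of 1] show "star i = star j"
    by (simp add: star_def)
qed

lemma star_share:
  assumes "c (i + 1) = c j"
  shows "share_edge H (star i) (star j)" "share_edge H (star j) (star i)"
proof -
  have "star (i + 1) = star j"
    using assms by (simp add: star_eq c_eq)
  then have "{c i, c j} \<subseteq> star i" "{c i, c j} \<subseteq> star j"
    using assms star_mem[of i] star_mem[of j] star_mem[of "i + 1"] by auto
  moreover have "adj H (c i) (c j)"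
    using assms c_near(1)[of i] by simp
  ultimately show "share_edge H (star i) (star j)" "share_edge H (star j) (star i)"
    using share_edgeI by metis+
qed

text \<open>An edge shared by two different stars joins their centres, so only consecutive stars are
  adjacent. For goodness, \<open>share_star_both\<close> puts the whole path around
  \<open>c i\<close> into \<open>S\<close>, which then shares an edge with
  \<open>star i\<close>.\<close>

lemma good_cycle_star: "good_cycle (KBe H) n star"
proof
  show "finite_simple_graph (KBe H)" by (rule finite_simple_graph_KBe[OF fsg])
  show "5 \<le> n" by (rule n_ge)
  show "star i \<in> verts (KBe H)" for i
    by (simp add: verts_KBe star_biclique)
  show "star i = star j \<longleftrightarrow> n dvd i - j" for i j by (rule star_eq)
  show "adj (KBe H) (star i) (star j) \<longleftrightarrow> n dvd i - j - 1 \<or> n dvd i - j + 1" for i j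
  proof
    assume "adj (KBe H) (star i) (star j)"
    then have ne: "star i \<noteq> star j" and sh: "share_edge H (star i) (star j)"
      by (auto simp: adj_KBe[OF fsg])
    from sh obtain a where a: "c j \<in> star i" "a \<in> star i" "a \<in> star j" "adj H (c j) a"
      by (rule share_star)
    have "c j \<noteq> c i" using ne by (auto simp: star_eq c_eq dvd_diff_commute)
    then have "a = c i"
      using star_edge[OF star_biclique star_mem a(1,2,4)] by blast
    then show "n dvd i - j - 1 \<or> n dvd i - j + 1"
      using a(4) c_adj adj_commute[of H a] by blast
  next
    assume *: "n dvd i - j - 1 \<or> n dvd i - j + 1"
    then have "\<not> n dvd i - j"
      using n_dvd_small[of 1] dvd_diff[of n "i - j" "i - j - 1"] dvd_diff[of n "i - j + 1" "i - j"]
      by auto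
    moreover have "share_edge H (star i) (star j)"
      using * star_share(1)[of i j] star_share(2)[of j i] dvd_diff_commute[of n "i + 1" j]
      by (auto simp: c_eq algebra_simps)
    ultimately show "adj (KBe H) (star i) (star j)"
      by (simp add: adj_KBe[OF fsg] star_biclique star_eq)
  qed
  show "adj (KBe H) S (star i)"
    if "S \<in> verts (KBe H)" "S \<notin> range star"
      "adj (KBe H) S (star (i - 1))" "adj (KBe H) S (star (i + 1))" for S i
  proof -
    have "c (i - 1) \<in> S" "c i \<in> S" "c (i + 1) \<in> S" "biclique H S"
      using share_star_both[of S i] that(3,4) by (auto simp: adj_KBe[OF fsg])
    then show ?thesis
      using that(2) c_near(1)[of i] star_mem[of i] star_biclique
        share_edgeI[of H "c i" "c (i + 1)" S "star i"]
      by (auto simp: adj_KBe[OF fsg])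
  qed
qed

text \<open>Vertices rather than indices are compared, since an index stands for its whole residue
  class modulo \<open>n\<close>.\<close>

definition pendant :: "int \<Rightarrow> 'a \<Rightarrow> bool" where
  "pendant i u \<longleftrightarrow> u \<in> verts H \<and> u \<notin> range c \<and> (\<forall>k. adj H u (c k) \<longleftrightarrow> c k = c i \<or> c k = c (i + 1))"

text \<open>The two moves to the next graph: an image under \<open>right_ext\<close> is attached at
  position \<open>i + 1\<close> of the cycle of stars, an image under \<open>left_ext\<close> at
  position \<open>i - 1\<close>.\<close>

definition right_ext :: "int \<Rightarrow> 'a \<Rightarrow> 'a set" where
  "right_ext i u = biclique_ext H {u, c (i + 1), c (i + 2)}"

definition left_ext :: "int \<Rightarrow> 'a \<Rightarrow> 'a set" where
  "left_ext i u = biclique_ext H {u, c i, c (i - 1)}"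

text \<open>The complete part of a necklace, attached to the cycle edge at position
  \<open>i\<close>.\<close>

definition pendant_clique :: "int \<Rightarrow> 'a set \<Rightarrow> bool" where
  "pendant_clique i K \<longleftrightarrow> (\<forall>u\<in>K. pendant i u) \<and> (\<forall>u\<in>K. \<forall>w\<in>K. u \<noteq> w \<longrightarrow> adj H u w)"

lemma pendant_near:
  assumes "pendant i u"
  shows "adj H u (c i)" "adj H u (c (i + 1))" "\<not> adj H u (c (i - 1))" "\<not> adj H u (c (i + 2))"
    "u \<noteq> c k"
  using assms by (auto simp: pendant_def c_eq n_dvd_small)

end

section \<open>Images of attached vertices in the edge-biclique graph\<close>

context good_cycle
begin

interpretation star: good_cycle "KBe H" n star
  by (rule good_cycle_star)

text \<open>Sharing an edge with \<open>star k\<close> requires containing \<open>c k\<close>, and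
  the edge at position \<open>i\<close> lies in both \<open>star i\<close> and
  \<open>star (i + 1)\<close>. A star contains three different cycle vertices, so \<open>S\<close>
  is none of the stars.\<close>

lemma pendant_star:
  assumes S: "biclique H S" and cS: "\<And>k. c k \<in> S \<longleftrightarrow> c k = c i \<or> c k = c (i + 1)"
  shows "star.pendant i S"
  unfolding star.pendant_def
proof (intro conjI allI)
  show "S \<in> verts (KBe H)" using S by (simp add: verts_KBe)
  have ne: "S \<noteq> star k" for k
  proof
    assume "S = star k"
    then have *: "c (k - 1) \<in> {c i, c (i + 1)}" "c k \<in> {c i, c (i + 1)}" "c (k + 1) \<in> {c i, c (i + 1)}"
      using star_mem[of k] cS by auto
    have "c (k - 1) \<noteq> c k" "c k \<noteq> c (k + 1)" "c (k - 1) \<noteq> c (k + 1)"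
      by (simp_all add: c_eq n_dvd_small)
    with * show False by auto
  qed
  then show "S \<notin> range star" by blast
  show "adj (KBe H) S (star k) \<longleftrightarrow> star k = star i \<or> star k = star (i + 1)" for k
  proof
    assume "adj (KBe H) S (star k)"
    then have "share_edge H S (star k)" by (simp add: adj_KBe[OF fsg])
    then have "c k \<in> S" by (rule share_star)
    then show "star k = star i \<or> star k = star (i + 1)"
      using cS by (simp add: star_eq c_eq)
  next
    assume "star k = star i \<or> star k = star (i + 1)"
    then have "{c i, c (i + 1)} \<subseteq> star k"
      using star_mem[of i] star_mem[of "i + 1"] by auto
    then have "share_edge H S (star k)"
      using cS by (intro share_edgeI[OF c_near(1)[of i]]) auto
    then show "adj (KBe H) S (star k)"
      using S ne star_biclique by (simp add: adj_KBe[OF fsg])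
  qed
qed

text \<open>A cycle vertex in \<open>S\<close> opposite to \<open>c (i + 1)\<close> is
  \<open>c i\<close> or \<open>c (i + 2)\<close>, and \<open>c i\<close> is out because it is
  adjacent to \<open>u\<close> on the same side. One on the side of \<open>c (i + 1)\<close> is
  adjacent to \<open>u\<close> and to \<open>c (i + 2)\<close>, which leaves only
  \<open>c (i + 1)\<close>.\<close>

lemma pendant_right:
  assumes u: "pendant i u" and S: "biclique H S" "u \<in> S" "c (i + 1) \<in> S" "c (i + 2) \<in> S"
  shows "star.pendant (i + 1) S"
proof (rule pendant_star[OF S(1)])
  fix k
  have "c k = c (i + 1) \<or> c k = c (i + 2)" if k: "c k \<in> S"
  proof (cases "adj H (c k) (c (i + 1))")
    case True
    then have "\<not> adj H u (c k)"
      using biclique_adj_iff[OF S(1,2,3) k] pendant_near[OF u] by (auto simp: adj_commute)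
    then have "c k \<noteq> c i" using pendant_near[OF u] by auto
    then show ?thesis using True by (auto simp: c_adj c_eq algebra_simps)
  next
    case False
    then have "adj H u (c k)" "adj H (c k) (c (i + 2))"
      using biclique_adj_iff[OF S(1,2,3) k] biclique_adj_iff[OF S(1) k S(3,4)]
        pendant_near[OF u] c_near(1)[of "i + 1"] by (auto simp: adj_commute add.assoc)
    moreover have "\<not> adj H (c i) (c (i + 2))" by (rule c_near)
    ultimately show ?thesis using u unfolding pendant_def by metis
  qed
  then show "c k \<in> S \<longleftrightarrow> c k = c (i + 1) \<or> c k = c (i + 1 + 1)"
    using S(3,4) by (auto simp: add.assoc)
qed

lemma pendant_left:
  assumes u: "pendant i u" and S: "biclique H S" "u \<in> S" "c i \<in> S" "c (i - 1) \<in> S"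
  shows "star.pendant (i - 1) S"
proof (rule pendant_star[OF S(1)])
  fix k
  have "c k = c (i - 1) \<or> c k = c i" if k: "c k \<in> S"
  proof (cases "adj H (c k) (c i)")
    case True
    then have "\<not> adj H u (c k)"
      using biclique_adj_iff[OF S(1,2,3) k] pendant_near[OF u] by (auto simp: adj_commute)
    then have "c k \<noteq> c (i + 1)" using pendant_near[OF u] by auto
    then show ?thesis using True by (auto simp: c_adj c_eq algebra_simps)
  next
    case False
    then have "adj H u (c k)" "adj H (c k) (c (i - 1))"
      using biclique_adj_iff[OF S(1,2,3) k] biclique_adj_iff[OF S(1) k S(3,4)]
        pendant_near[OF u] c_near(2)[of i] by (auto simp: adj_commute)
    moreover have "\<not> adj H (c (i + 1)) (c (i - 1))" using c_near(3) adj_commute by metis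
    ultimately show ?thesis using u unfolding pendant_def by metis
  qed
  then show "c k \<in> S \<longleftrightarrow> c k = c (i - 1) \<or> c k = c (i - 1 + 1)"
    using S(3,4) by auto
qed

lemma right_ext:
  assumes "pendant i u"
  shows "biclique H (right_ext i u)" "u \<in> right_ext i u" "c (i + 1) \<in> right_ext i u"
    "c (i + 2) \<in> right_ext i u" "star.pendant (i + 1) (right_ext i u)"
proof -
  have "adj H (c (i + 1)) (c (i + 2))" using c_near(1)[of "i + 1"] by (simp add: add.assoc)
  note * = biclique_ext_path[OF fsg pendant_near(2)[OF assms] this pendant_near(4)[OF assms]]
  show "biclique H (right_ext i u)" "u \<in> right_ext i u" "c (i + 1) \<in> right_ext i u"
    "c (i + 2) \<in> right_ext i u"
    using * unfolding right_ext_def by auto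
  then show "star.pendant (i + 1) (right_ext i u)"
    by (rule pendant_right[OF assms])
qed

lemma left_ext:
  assumes "pendant i u"
  shows "biclique H (left_ext i u)" "u \<in> left_ext i u" "c i \<in> left_ext i u"
    "c (i - 1) \<in> left_ext i u" "star.pendant (i - 1) (left_ext i u)"
proof -
  have "adj H (c i) (c (i - 1))" using c_near(2)[of i] by (simp add: adj_commute)
  note * = biclique_ext_path[OF fsg pendant_near(1)[OF assms] this pendant_near(3)[OF assms]]
  show "biclique H (left_ext i u)" "u \<in> left_ext i u" "c i \<in> left_ext i u"
    "c (i - 1) \<in> left_ext i u"
    using * unfolding left_ext_def by auto
  then show "star.pendant (i - 1) (left_ext i u)"
    by (rule pendant_left[OF assms])
qed

text \<open>All images contain the edge from \<open>a\<close> to \<open>b\<close>, so different ones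
  are adjacent. If two vertices had the same image, they would form a triangle with \<open>a\<close>
  inside a biclique.\<close>

lemma pendant_clique_image:
  assumes K: "pendant_clique i K" and a: "\<And>u. u \<in> K \<Longrightarrow> adj H u a"
    and f: "\<And>u. u \<in> K \<Longrightarrow> u \<in> f u \<and> a \<in> f u \<and> b \<in> f u \<and> star.pendant j (f u)" and "adj H a b"
  shows "star.pendant_clique j (f ` K)" "inj_on f K"
proof -
  have bc: "biclique H (f u)" if "u \<in> K" for u
    using f[OF that] by (simp add: star.pendant_def verts_KBe)
  have "share_edge H (f u) (f v)" if "u \<in> K" "v \<in> K" for u v
    using f that by (intro share_edgeI[OF \<open>adj H a b\<close>]) auto
  with bc f show "star.pendant_clique j (f ` K)"
    unfolding star.pendant_clique_def by (auto simp: adj_KBe[OF fsg])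
  show "inj_on f K"
  proof (rule inj_onI, rule ccontr)
    fix u v assume uv: "u \<in> K" "v \<in> K" "f u = f v" "u \<noteq> v"
    then have "adj H u v" using K by (auto simp: pendant_clique_def)
    moreover have "v \<in> f u" using f uv by metis
    ultimately show False
      using biclique_adj_iff[OF bc[OF uv(1)], of u a v] f[OF uv(1)] a[OF uv(1)] a[OF uv(2)]
      by (auto simp: adj_commute)
  qed
qed

lemma pendant_clique_right:
  assumes "pendant_clique i K"
  shows "star.pendant_clique (i + 1) (right_ext i ` K)" "inj_on (right_ext i) K"
proof -
  have "adj H (c (i + 1)) (c (i + 2))" using c_near(1)[of "i + 1"] by (simp add: add.assoc)
  moreover have "pendant i u" if "u \<in> K" for u
    using assms that by (simp add: pendant_clique_def)
  ultimately show "star.pendant_clique (i + 1) (right_ext i ` K)" "inj_on (right_ext i) K"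
    using pendant_clique_image[OF assms pendant_near(2) _ \<open>adj H _ _\<close>, of "right_ext i" "i + 1"]
      right_ext by simp_all
qed

lemma pendant_clique_left:
  assumes "pendant_clique i K"
  shows "star.pendant_clique (i - 1) (left_ext i ` K)" "inj_on (left_ext i) K"
proof -
  have "adj H (c i) (c (i - 1))" using c_near(2)[of i] by (simp add: adj_commute)
  moreover have "pendant i u" if "u \<in> K" for u
    using assms that by (simp add: pendant_clique_def)
  ultimately show "star.pendant_clique (i - 1) (left_ext i ` K)" "inj_on (left_ext i) K"
    using pendant_clique_image[OF assms pendant_near(1) _ \<open>adj H _ _\<close>, of "left_ext i" "i - 1"]
      left_ext by simp_all
qed

text \<open>Here \<open>E\<close> and \<open>Q\<close> come from moving \<open>u\<close> right
  twice, while \<open>F\<close> comes from a left move followed by a right move. A shared edge would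
  yield a biclique \<open>z\<close> of \<open>H\<close> whose trace on \<open>E\<close> contains a
  vertex \<open>r\<close> adjacent to both \<open>c i\<close> and \<open>c (i + 3)\<close>. Goodness
  of the cycle rules out such an \<open>r\<close>.\<close>

lemma no_shared_edge:
  assumes u: "pendant i u" and E: "biclique H E" "u \<in> E" "c (i + 1) \<in> E" "c (i + 2) \<in> E"
    and D: "star.pendant (i - 1) D"
    and F: "biclique (KBe H) F" "D \<in> F" "star i \<in> F" "star (i + 1) \<in> F"
    and Q: "biclique (KBe H) Q" "E \<in> Q" "star (i + 2) \<in> Q" "star (i + 3) \<in> Q"
  shows "\<not> share_edge (KBe H) F Q"
proof
  let ?A = "adj (KBe H)"
  assume "share_edge (KBe H) F Q"
  then obtain x y where xy: "x \<in> F" "y \<in> F" "x \<in> Q" "y \<in> Q" "?A x y"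
    unfolding share_edge_def by blast
  \<comment> \<open>One end of the shared edge lies on the side of \<open>star (i + 2)\<close> in
    \<open>Q\<close>.\<close>
  then have "\<not> ?A x (star (i + 2)) \<or> \<not> ?A y (star (i + 2))"
    using biclique_adj_iff[OF Q(1) xy(3) Q(3) xy(4)] by (auto simp: adj_commute)
  then obtain z where z: "z \<in> F" "z \<in> Q" "\<not> ?A z (star (i + 2))"
    using xy by blast
  have E_pendant: "star.pendant (i + 1) E" by (rule pendant_right[OF u E])
  have w: "?A (star i) (star (i + 1))" "?A (star (i + 1)) (star (i + 2))"
    "?A (star (i + 2)) (star (i + 3))"
    using star.c_near(1)[of i] star.c_near(1)[of "i + 1"] star.c_near(1)[of "i + 2"]
    by (simp_all add: add.assoc)
  have z3: "?A z (star (i + 3))" and zE: "?A z E"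
    using biclique_adj_iff[OF Q(1) z(2) Q(3) Q(4)] biclique_adj_iff[OF Q(1) z(2) Q(3) Q(2)]
      z(3) w star.pendant_near(2)[OF E_pendant] by (auto simp: adj_commute add.assoc)
  have "?A D (star i)" "\<not> ?A D (star (i + 1))"
    using star.pendant_near[OF D] by (simp_all add: algebra_simps)
  have "\<not> ?A D (star (i + 2))"
    using D by (simp add: star.pendant_def star_eq n_dvd_small)
  \<comment> \<open>In \<open>F\<close> the vertices \<open>D\<close> and
    \<open>star (i + 1)\<close> are on one side, but \<open>star (i + 2)\<close> is adjacent only to
    the second.\<close>
  have "star (i + 2) \<notin> F"
    using biclique_adj_iff[OF F(1,2,4), of "star (i + 2)"] w
      \<open>\<not> ?A D (star (i + 1))\<close> \<open>\<not> ?A D (star (i + 2))\<close> by auto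
  then have z2: "z \<noteq> star (i + 2)" using z(1) by blast
  have zb: "biclique H z" using zE by (simp add: adj_KBe[OF fsg])
  \<comment> \<open>Otherwise \<open>z\<close> would be a common neighbour of
    \<open>star (i + 1)\<close> and \<open>star (i + 3)\<close>, hence equal or adjacent to
    \<open>star (i + 2)\<close>.\<close>
  have "\<not> ?A z (star (i + 1))"
    using star.common_neighbour[of z "i + 2"] z(3) z2 z3 by (auto simp: algebra_simps)
  then have z0: "?A z (star i)"
    using biclique_adj_iff[OF F(1) z(1) F(4) F(3)] w by (auto simp: adj_commute)
  have "share_edge H z (star i)" "share_edge H z (star (i + 3))" "share_edge H z E"
    using z0 z3 zE by (simp_all add: adj_KBe[OF fsg])
  then obtain p q where c0: "c i \<in> z" and c3: "c (i + 3) \<in> z"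
    and pq: "p \<in> z" "q \<in> z" "p \<in> E" "q \<in> E" "adj H p q"
    unfolding share_edge_def[of H z E] by (blast elim: share_star)
  \<comment> \<open>In \<open>z\<close> the vertex \<open>c i\<close> is opposite to exactly one end
    of the edge shared with \<open>E\<close>; that end becomes \<open>r\<close>.\<close>
  then have "adj H p (c i) \<or> adj H q (c i)"
    using biclique_adj_iff[OF zb pq(1) c0 pq(2)] by (auto simp: adj_commute)
  then obtain r where r: "r \<in> z" "r \<in> E" "adj H r (c i)" using pq by blast
  have r3: "adj H r (c (i + 3))"
    using biclique_adj_iff[OF zb r(1) c0 c3] r(3) c_near(5) by blast
  have c12: "adj H (c (i + 1)) (c (i + 2))" using c_near(1)[of "i + 1"] by (simp add: add.assoc)
  \<comment> \<open>In \<open>E\<close> the vertex \<open>r\<close> is adjacent to exactly one of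
    \<open>c (i + 1)\<close> and \<open>c (i + 2)\<close>. Goodness then forces \<open>r\<close> to
    be the other one, which is not adjacent to both \<open>c i\<close> and
    \<open>c (i + 3)\<close>.\<close>
  show False
  proof (cases "adj H r (c (i + 1))")
    case True
    then have "r = c (i + 2) \<or> adj H r (c (i + 2))"
      using common_neighbour[of r "i + 2"] r3 by (simp add: algebra_simps)
    moreover have "\<not> adj H r (c (i + 2))"
      using biclique_adj_iff[OF E(1) r(2) E(3,4)] True c12 by blast
    ultimately show False using r(3) c_near(4)[of i] by (auto simp: adj_commute)
  next
    case False
    then have "adj H r (c (i + 2))"
      using biclique_adj_iff[OF E(1) r(2) E(3,4)] c12 by blast
    then have "r = c (i + 1)"
      using common_neighbour[of r "i + 1"] r(3) False by (simp add: algebra_simps)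
    then show False using r3 c_near(4)[of "i + 1"] by (simp add: add.assoc)
  qed
qed

section \<open>From periodic cycles back to necklaces given by lists\<close>

lemma has_good_necklace:
  assumes K: "pendant_clique 1 K" "finite K" "K \<noteq> {}"
  shows "has_good_necklace H (nat n) (card K)"
proof -
  define cyc where "cyc = map (\<lambda>i. c (int i)) [0..<nat n]"
  have len: "length cyc = nat n" by (simp add: cyc_def)
  have nth: "cyc ! i = c (int i)" if "i < nat n" for i
    using that by (simp add: cyc_def)
  have c_mod: "c (k mod n) = c k" for k
    unfolding c_eq by (simp add: mod_eq_dvd_iff[symmetric])
  have nth_mod: "cyc ! (i mod nat n) = c (int i)" for i
    using n_ge nth[of "i mod nat n"] c_mod[of "int i"] by (simp add: zmod_int)
  have set: "set cyc = range c"
  proof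
    show "range c \<subseteq> set cyc"
    proof
      fix v assume "v \<in> range c"
      then obtain k where "v = c k" by blast
      then have "v = c (int (nat (k mod n)))" using n_ge c_mod by simp
      moreover have "nat (k mod n) < nat n" using n_ge by simp
      ultimately show "v \<in> set cyc" using nth nth_mem len by metis
    qed
  qed (auto simp: cyc_def)
  have inj: "c (int i) = c (int j) \<longleftrightarrow> i = j" if "i < nat n" "j < nat n" for i j
  proof -
    have "\<bar>int i - int j\<bar> < n" using that by linarith
    then have "n dvd int i - int j \<longleftrightarrow> int i - int j = 0"
      using dvd_imp_le_int[of "int i - int j" n] by auto
    then show ?thesis by (simp add: c_eq)
  qed
  have step: "c (int j) = c (int i + 1) \<longleftrightarrow> j = (i + 1) mod nat n" if "j < nat n" for i j
    using inj[of j "(i + 1) mod nat n"] that nth_mod[of "i + 1"] nth[of "(i + 1) mod nat n"]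
    by (simp add: algebra_simps)
  have "induced_necklace H (nat n) (card K) cyc K"
    unfolding induced_necklace_def
  proof (intro conjI)
    show "3 \<le> nat n" using n_ge by simp
    show "1 \<le> card K" using K by (simp add: Suc_le_eq card_gt_0_iff)
    show "length cyc = nat n" by (rule len)
    show "distinct cyc" using inj by (auto simp: cyc_def distinct_map intro!: inj_onI)
    show "set cyc \<subseteq> verts H" using c_verts by (auto simp: set)
    show "K \<subseteq> verts H" "K \<inter> set cyc = {}"
      using K(1) unfolding pendant_clique_def pendant_def set by blast+
    show "finite K" by fact
    show "card K = card K" ..
    show "\<forall>i<nat n. \<forall>j<nat n. adj H (cyc ! i) (cyc ! j) \<longleftrightarrow> (j = (i + 1) mod nat n \<or> i = (j + 1) mod nat n)"
    proof (intro allI impI)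
      fix i j assume ij: "i < nat n" "j < nat n"
      have "adj H (cyc ! i) (cyc ! j) \<longleftrightarrow> c (int j) = c (int i + 1) \<or> c (int i) = c (int j + 1)"
        using ij by (auto simp: nth c_adj c_eq dvd_diff_commute[of n "int j"] algebra_simps)
      then show "adj H (cyc ! i) (cyc ! j) \<longleftrightarrow> (j = (i + 1) mod nat n \<or> i = (j + 1) mod nat n)"
        using ij step by simp
    qed
    show "\<forall>u\<in>K. \<forall>w\<in>K. u \<noteq> w \<longrightarrow> adj H u w"
      using K(1) by (simp add: pendant_clique_def)
    show "\<exists>j<nat n. \<forall>u\<in>K. \<forall>i<nat n. adj H u (cyc ! i) \<longleftrightarrow> (i = j \<or> i = (j + 1) mod nat n)"
    proof (intro exI[of _ 1] conjI ballI allI impI)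
      show "1 < nat n" using n_ge by simp
      fix u i assume "u \<in> K" "i < nat n"
      then show "adj H u (cyc ! i) \<longleftrightarrow> (i = 1 \<or> i = (1 + 1) mod nat n)"
        using K(1) inj[of i 1] step[of i 1] \<open>1 < nat n\<close>
        by (simp add: pendant_clique_def pendant_def nth)
    qed
  qed
  moreover have "good_neighbours H cyc"
    unfolding good_neighbours_def len
  proof (intro ballI allI impI)
    fix v i
    assume v: "v \<in> verts H - set cyc" and i: "i < nat n" and
      a: "adj H v (cyc ! ((i + nat n - 1) mod nat n)) \<and> adj H v (cyc ! ((i + 1) mod nat n))"
    \<comment> \<open>Adding \<open>n\<close> first keeps the subtraction on naturals from
      truncating at \<open>i = 0\<close>; periodicity removes it again.\<close>
    have "c (int (i + nat n - 1)) = c (int i - 1)"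
      using n_ge by (simp add: c_eq of_nat_diff)
    then show "adj H v (cyc ! i)"
      using good[of v "int i"] v a i by (simp add: nth_mod nth set add.commute)
  qed
  ultimately show ?thesis unfolding has_good_necklace_def by blast
qed

end

section \<open>Three iterations of the construction\<close>

context good_cycle
begin

interpretation star: good_cycle "KBe H" n star
  by (rule good_cycle_star)

interpretation star2: good_cycle "KBe (KBe H)" n star.star
  by (rule star.good_cycle_star)

interpretation star3: good_cycle "KBe (KBe (KBe H))" n star2.star
  by (rule star2.good_cycle_star)

theorem larger_necklace:
  assumes K: "pendant_clique 0 K" "finite K" "K \<noteq> {}"
  shows "has_good_necklace (KBe (KBe (KBe H))) (nat n) (Suc (card K))"
proof -
  obtain u where "u \<in> K" using K by blast
  then have u: "pendant 0 u" using K by (simp add: pendant_clique_def)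
  \<comment> \<open>The vertex \<open>u\<close> passes through positions 0, 1, 2, 1 and ends as
    \<open>T\<close>. The clique \<open>K\<close> passes through 0, -1, 0, 1, with \<open>f\<close>
    for its first two moves and \<open>s\<close> for the third.\<close>
  define E where "E = right_ext 0 u"
  define Q where "Q = star.right_ext 1 E"
  define T where "T = star2.left_ext 2 Q"
  define f where "f = (\<lambda>v. star.right_ext (- 1) (left_ext 0 v))"
  define s where "s = star2.right_ext 0"
  have E: "star.pendant 1 E" using right_ext(5)[OF u] by (simp add: E_def)
  have Q: "star2.pendant 2 Q" using star.right_ext(5)[OF E] by (simp add: Q_def)
  have T: "star3.pendant 1 T" using star2.left_ext(5)[OF Q] by (simp add: T_def)
  have D_clique: "star.pendant_clique (- 1) (left_ext 0 ` K)" and D_inj: "inj_on (left_ext 0) K"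
    using pendant_clique_left[OF K(1)] by simp_all
  have F_clique: "star2.pendant_clique 0 (f ` K)" and F_inj: "inj_on f K"
    using star.pendant_clique_right[OF D_clique] D_inj
    by (simp_all add: f_def image_image inj_on_def)
  have S_clique: "star3.pendant_clique 1 (s ` f ` K)" and S_inj: "inj_on s (f ` K)"
    using star2.pendant_clique_right[OF F_clique] by (simp_all add: s_def)
  have S: "biclique (KBe (KBe H)) (s F)" "F \<in> s F" "star.star 1 \<in> s F" "star.star 2 \<in> s F"
    and FC: "adj (KBe (KBe H)) F (star.star 1)" "\<not> adj (KBe (KBe H)) F (star.star 2)"
    if "F \<in> f ` K" for F
  proof -
    have "star2.pendant 0 F"
      using F_clique that by (auto simp: star2.pendant_clique_def)
    from star2.right_ext[OF this] star2.pendant_near[OF this]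
    show "biclique (KBe (KBe H)) (s F)" "F \<in> s F" "star.star 1 \<in> s F" "star.star 2 \<in> s F"
      "adj (KBe (KBe H)) F (star.star 1)" "\<not> adj (KBe (KBe H)) F (star.star 2)"
      by (simp_all add: s_def)
  qed
  have TT: "biclique (KBe (KBe H)) T" "Q \<in> T" "star.star 2 \<in> T" "star.star 1 \<in> T"
    using star2.left_ext[OF Q] by (simp_all add: T_def)
  have QC: "adj (KBe (KBe H)) Q (star.star 2)" "\<not> adj (KBe (KBe H)) Q (star.star 1)"
    using star2.pendant_near[OF Q] by simp_all
  have C12: "adj (KBe (KBe H)) (star.star 1) (star.star 2)"
    using star2.c_near(1)[of 1] by simp
  \<comment> \<open>If the two coincided, \<open>F\<close> would be on the side of
    \<open>star.star 2\<close> and \<open>Q\<close> on that of \<open>star.star 1\<close>, so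
    \<open>F\<close> and \<open>Q\<close> would be adjacent, that is, share an edge.\<close>
  have ne: "T \<noteq> s F" if F: "F \<in> f ` K" for F
  proof
    assume "T = s F"
    then have "adj (KBe (KBe H)) F Q"
      using biclique_adj_iff[OF S(1,2,3)[OF F], of Q] TT(2) FC[OF F] QC
      by (auto simp: adj_commute)
    then have "share_edge (KBe H) F Q" by (simp add: adj_KBe[OF star.fsg])
    moreover obtain v where v: "v \<in> K" "F = f v" using F by blast
    have D: "star.pendant (- 1) (left_ext 0 v)"
      using D_clique v(1) by (simp add: star.pendant_clique_def)
    have "\<not> share_edge (KBe H) F Q"
      using no_shared_edge[OF u, of E "left_ext 0 v" F Q] right_ext[OF u] star.right_ext[OF D]
        star.right_ext[OF E] D unfolding v(2) f_def by (simp add: E_def Q_def)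
    ultimately show False by blast
  qed
  \<comment> \<open>The right move from position 0 and the left move from position 2 use the same
    cycle edge, between \<open>star.star 1\<close> and \<open>star.star 2\<close>.\<close>
  have adj_T: "adj (KBe (KBe (KBe H))) T (s F)" if F: "F \<in> f ` K" for F
    using ne[OF F] S[OF F] TT share_edgeI[OF C12, of T "s F"]
    by (simp add: adj_KBe[OF star2.fsg])
  let ?K = "insert T (s ` f ` K)"
  have "star3.pendant_clique 1 ?K"
    using S_clique T adj_T unfolding star3.pendant_clique_def
    by (auto simp: adj_commute)
  moreover have "card ?K = Suc (card K)"
    using ne K(2) by (subst card_insert_disjoint) (auto simp: card_image S_inj F_inj)
  ultimately show ?thesis
    using star3.has_good_necklace[of ?K] K(2) by simp
qed

end

section \<open>From a necklace given by a list to a periodic cycle\<close>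

lemma good_cycle_of_necklace:
  assumes "finite_simple_graph G" "5 \<le> n" "has_good_necklace G n m"
  obtains c K where "good_cycle G (int n) c" "good_cycle.pendant_clique G c 0 K"
    "finite K" "card K = m" "1 \<le> m"
proof -
  from assms(3) obtain cyc K where nk: "induced_necklace G n m cyc K" and gn: "good_neighbours G cyc"
    unfolding has_good_necklace_def by blast
  from nk obtain j where j: "j < n"
    "\<And>u i. u \<in> K \<Longrightarrow> i < n \<Longrightarrow> adj G u (cyc ! i) \<longleftrightarrow> (i = j \<or> i = (j + 1) mod n)"
    unfolding induced_necklace_def by blast
  have K: "K \<subseteq> verts G" "finite K" "card K = m" "1 \<le> m" "K \<inter> set cyc = {}"
    "\<forall>u\<in>K. \<forall>w\<in>K. u \<noteq> w \<longrightarrow> adj G u w"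
    using nk unfolding induced_necklace_def by simp_all
  have len: "length cyc = n" and dist: "distinct cyc"
    and adj: "\<And>i k. i < n \<Longrightarrow> k < n \<Longrightarrow> adj G (cyc ! i) (cyc ! k) \<longleftrightarrow> (k = (i + 1) mod n \<or> i = (k + 1) mod n)"
    using nk unfolding induced_necklace_def by blast+
  \<comment> \<open>The shift by \<open>j\<close> rotates the cycle so that the clique is attached
    at position 0; reduction modulo \<open>n\<close> makes the indexing periodic.\<close>
  define r where "r = (\<lambda>k::int. nat ((k + int j) mod int n))"
  define c where "c = (\<lambda>k. cyc ! r k)"
  have r_less: "r k < n" for k
    using assms(2) by (simp add: r_def nat_less_iff)
  have int_r: "int (r k) = (k + int j) mod int n" for k
    using assms(2) by (simp add: r_def)
  have r_eq: "r i = r k \<longleftrightarrow> int n dvd i - k" for i k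
    using int_r[of i] int_r[of k] by (simp add: mod_eq_dvd_iff flip: int_int_eq)
  have r_Suc: "(r k + 1) mod n = r (k + 1)" for k
  proof -
    have "int ((r k + 1) mod n) = int (r (k + 1))"
      by (simp add: int_r zmod_int mod_simps algebra_simps)
    then show ?thesis by linarith
  qed
  have r_pred: "(r k + n - 1) mod n = r (k - 1)" for k
  proof -
    have "int ((r k + n - 1) mod n) = (int (r k) + int n - 1) mod int n"
      using assms(2) by (simp add: zmod_int of_nat_diff)
    also have "\<dots> = (int (r k) - 1) mod int n"
      using mod_add_self2[of "int (r k) - 1" "int n"] by (simp add: algebra_simps)
    also have "\<dots> = int (r (k - 1))"
      by (simp add: int_r mod_simps algebra_simps)
    finally show ?thesis by linarith
  qed
  have c_range: "c k \<in> set cyc" for k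
    using r_less len by (simp add: c_def)
  have set: "set cyc = range c"
  proof
    show "set cyc \<subseteq> range c"
    proof
      fix v assume "v \<in> set cyc"
      then obtain i where i: "i < n" "v = cyc ! i" using len by (auto simp: in_set_conv_nth)
      then have "r (int i - int j) = i" by (simp add: r_def)
      then have "v = c (int i - int j)" using i by (simp add: c_def)
      then show "v \<in> range c" by blast
    qed
  qed (use c_range in blast)
  have c_eq: "c i = c k \<longleftrightarrow> int n dvd i - k" for i k
    using nth_eq_iff_index_eq[OF dist, of "r i" "r k"] r_less len by (simp add: c_def r_eq)
  have gc: "good_cycle G (int n) c"
  proof
    show "finite_simple_graph G" by fact
    show "5 \<le> int n" using assms(2) by simp
    show "c k \<in> verts G" for k using c_range nk unfolding induced_necklace_def by blast
    show "c i = c k \<longleftrightarrow> int n dvd i - k" for i k by (rule c_eq)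
    show "adj G (c i) (c k) \<longleftrightarrow> int n dvd i - k - 1 \<or> int n dvd i - k + 1" for i k
    proof -
      have "adj G (c i) (c k) \<longleftrightarrow> int n dvd k - (i + 1) \<or> int n dvd i - (k + 1)"
        unfolding c_def adj[OF r_less r_less] r_Suc r_eq ..
      moreover have "int n dvd k - (i + 1) \<longleftrightarrow> int n dvd i + 1 - k"
        by (rule dvd_diff_commute)
      moreover have "i + 1 - k = i - k + 1" "i - (k + 1) = i - k - 1"
        by simp_all
      ultimately show ?thesis by metis
    qed
    show "adj G v (c i)" if "v \<in> verts G" "v \<notin> range c" "adj G v (c (i - 1))" "adj G v (c (i + 1))" for v i
      using gn that r_less[of i] r_Suc[of i] r_pred[of i]
      unfolding good_neighbours_def len set c_def by auto
  qed
  have r0: "r 0 = j" using j(1) by (simp add: r_def)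
  have "good_cycle.pendant G c 0 u" if "u \<in> K" for u
  proof -
    have "adj G u (c k) \<longleftrightarrow> c k = c 0 \<or> c k = c (0 + 1)" for k
      using j(2)[OF that r_less, of k] r_Suc[of 0] r0 r_eq[of k 0] r_eq[of k 1]
      by (simp add: c_eq) (simp add: c_def)
    then show ?thesis
      unfolding good_cycle.pendant_def[OF gc] using that K(1,5) set by blast
  qed
  then have "good_cycle.pendant_clique G c 0 K"
    unfolding good_cycle.pendant_clique_def[OF gc] using K(6) by blast
  then show thesis
    by (rule that[OF gc _ K(2-4)])
qed

theorem mainTheorem10:
  fixes G :: "'a graph" and n m :: nat
  assumes "finite_simple_graph G"
    and "n \<ge> 5" and "m \<ge> 1"
    and "has_good_necklace G n m"
  shows "(\<exists>m'>m. has_good_necklace (KBe (KBe G)) n m') \<or>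
         (\<exists>m'>m. has_good_necklace (KBe (KBe (KBe G))) n m')"
proof -
  from good_cycle_of_necklace[OF assms(1,2,4)] obtain c K where
    c: "good_cycle G (int n) c" "good_cycle.pendant_clique G c 0 K" "finite K" "card K = m" "1 \<le> m" .
  \<comment> \<open>Since \<open>1 \<le> m\<close>, the clique is nonempty and has a vertex to send
    along the second track; the larger size is \<open>Suc m\<close>.\<close>
  then have "has_good_necklace (KBe (KBe (KBe G))) n (Suc m)"
    using good_cycle.larger_necklace[OF c(1,2,3)] by fastforce
  then show ?thesis by blast
qed

end
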